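(* Let $B_1,B_2>0$ be absolute constants such that for all integers $N\ge2$, all $\nu,\tau>0$, all mean-zero $g\in L^4(\mathbb T)$ and all $g_1\in L^{4/3}(\mathbb T)$, $$\|(1+\nu\tau\Delta^2)^{-1}g\|_{L^\infty(\mathbb T)}\le B_1(\nu\tau)^{-\frac1{16}}\|g\|_{L^4(\mathbb T)},\qquad \|\tau\Delta(1+\nu\tau\Delta^2)^{-1}\Pi_Ng_1\|_{L^\infty(\mathbb T)}\le B_2\,\tau(\nu\tau)^{-\frac{11}{16}}\|g_1\|_{L^{4/3}(\mathbb T)}.$$ Let $\nu>0$ and let $N\ge 2$ be an integer. Assume $u_0\in H^1(\mathbb T)$ is real-valued and has mean zero, let $u^0=\Pi_Nu_0$, and assume $\|u^0\|_{L^\infty(\mathbb T)}=L_0<\infty$ with $L_0\ne0$. Put $E_0=\mathcal E(u^0)$, $$\beta_1=B_1\sqrt{1+2\sqrt{E_0}},\qquad \beta_2=2B_2\sqrt{E_0}\,\sqrt{1+2\sqrt{E_0}},$$ $$\tau_{\max}=\min\Big\{\frac{8\nu}{9L_0^4},\ \tau_{\max}^{(1)}\Big\},\qquad \tau_{\max}^{(1)}=0.118\,\nu^{\frac53}\min\{\beta_1^{-\frac{16}3},\ \beta_2^{-\frac{16}9}\}.$$ Then for any $0<\tau\le\tau_{\max}$, the solution of the scheme $$\frac{u^{n+1}-u^n}{\tau}=-\nu\Delta^2u^{n+1}+\Delta\Pi_N(f(u^n)),\quad n\ge 0,$$ satisfies $\mathcal E(u^{n+1})\le\mathcal E(u^n)$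 for all $n\ge 0$.
   Context: $\mathbb T=\mathbb R/\mathbb Z=[-\frac12,\frac12)$ is the $1$-periodic torus, and $\Delta=\partial_{xx}$. $f(u)=u^3-u$. The energy is $$\mathcal E(u)=\int_{\mathbb T}\Big(\tfrac12\nu|\nabla u|^2+\tfrac14(u^2-1)^2\Big)dx .$$ Fourier convention: $\hat g(k)=\int_{\mathbb T}g(x)e^{-2\pi i kx}dx$, $g(x)=\sum_{k\in\mathbb Z}\hat g(k)e^{2\pi i kx}$. $\Pi_N$ is the projection onto $X_N=\operatorname{Span}\{\cos(2\pi kx),\sin(2\pi kx):k\in\mathbb Z,\ |k|\le N\}$; i.e. $\Pi_N$ truncates to Fourier modes with $|k|\le N$. $(1+\nu\tau\Delta^2)^{-1}$ and $\tau\Delta(1+\nu\tau\Delta^2)^{-1}$ are the Fourier multipliers with symbols $(1+\nu\tau(2\pi|k|)^4)^{-1}$ and $-\tau(2\pi|k|)^2(1+\nu\tau(2\pi|k|)^4)^{-1}$. Each $u^{n+1}\in X_N$ is uniquely determined by $u^n$ through the scheme. *)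

theory Defs
  imports "HOL-Probability.Essential_Supremum"
begin

text \<open>
  Functions on the torus \<open>\<T> = \<real>/\<int>\<close> are represented by real-valued \<open>1\<close>-periodic functions on
  the real line; integrals and essential suprema are taken over the fundamental domain
  \<open>[-1/2, 1/2)\<close>.
\<close>

definition periodic1 :: "(real \<Rightarrow> real) \<Rightarrow> bool" where
  "periodic1 g \<longleftrightarrow> (\<forall>x. g (x + 1) = g x)"

abbreviation torus :: "real measure" where
  "torus \<equiv> lebesgue_on {-1/2..<1/2}"

definition mean_zero :: "(real \<Rightarrow> real) \<Rightarrow> bool" where
  "mean_zero g \<longleftrightarrow> (\<integral>x. g x \<partial>torus) = 0"

definition Lp :: "real \<Rightarrow> (real \<Rightarrow> real) set" where
  "Lp p = {g. periodic1 g \<and> g \<in> borel_measurable torus \<and> integrable torus (\<lambda>x. \<bar>g x\<bar> powr p)}"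

definition Lp_norm :: "real \<Rightarrow> (real \<Rightarrow> real) \<Rightarrow> real" where
  "Lp_norm p g = (\<integral>x. \<bar>g x\<bar> powr p \<partial>torus) powr (1 / p)"

text \<open>Extended-real valued, so that a bound on it includes essential boundedness.\<close>

definition Linf_norm :: "(real \<Rightarrow> real) \<Rightarrow> ereal" where
  "Linf_norm g = esssup torus (\<lambda>x. ereal \<bar>g x\<bar>)"

definition fourier_coeff :: "(real \<Rightarrow> real) \<Rightarrow> int \<Rightarrow> complex" where
  "fourier_coeff g k = (\<integral>x. of_real (g x) * exp (- 2 * of_real pi * \<i> * of_int k * of_real x) \<partial>torus)"

definition H1 :: "(real \<Rightarrow> real) set" where
  "H1 = {g \<in> Lp 2. (\<lambda>k::int. (1 + (2 * pi * \<bar>real_of_int k\<bar>)\<^sup>2) * (cmod (fourier_coeff g k))\<^sup>2) summable_on UNIV}"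

text \<open>
  The Fourier multiplier with symbol \<open>m\<close>, as a pointwise sum of the Fourier series. All symbols
  below are real and even, and are either finitely supported or of order \<open>k\<^sup>-\<^sup>2\<close> or \<open>k\<^sup>-\<^sup>4\<close>. Hence, for
  integrable real \<open>g\<close>, the series converges absolutely and its sum is real, so that \<open>Re\<close> only
  changes the type.
\<close>

definition fourier_multiplier :: "(int \<Rightarrow> real) \<Rightarrow> (real \<Rightarrow> real) \<Rightarrow> real \<Rightarrow> real" where
  "fourier_multiplier m g x =
     Re (\<Sum>\<^sub>\<infinity>k. of_real (m k) * fourier_coeff g k * exp (2 * of_real pi * \<i> * of_int k * of_real x))"

definition Pi_proj :: "nat \<Rightarrow> (real \<Rightarrow> real) \<Rightarrow> real \<Rightarrow> real" where
  "Pi_proj N = fourier_multiplier (\<lambda>k. if \<bar>k\<bar> \<le> int N then 1 else 0)"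

text \<open>\<open>(1 + \<nu>\<tau>\<Delta>\<^sup>2)\<^sup>-\<^sup>1\<close>\<close>

definition biharm_resolvent :: "real \<Rightarrow> real \<Rightarrow> (real \<Rightarrow> real) \<Rightarrow> real \<Rightarrow> real" where
  "biharm_resolvent \<nu> \<tau> =
     fourier_multiplier (\<lambda>k. inverse (1 + \<nu> * \<tau> * (2 * pi * \<bar>real_of_int k\<bar>) ^ 4))"

text \<open>\<open>\<tau>\<Delta>(1 + \<nu>\<tau>\<Delta>\<^sup>2)\<^sup>-\<^sup>1\<close>\<close>

definition lap_biharm_resolvent :: "real \<Rightarrow> real \<Rightarrow> (real \<Rightarrow> real) \<Rightarrow> real \<Rightarrow> real" where
  "lap_biharm_resolvent \<nu> \<tau> =
     fourier_multiplier (\<lambda>k. - \<tau> * (2 * pi * \<bar>real_of_int k\<bar>)\<^sup>2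
                               * inverse (1 + \<nu> * \<tau> * (2 * pi * \<bar>real_of_int k\<bar>) ^ 4))"

text \<open>The real span of \<open>cos (2\<pi>kx)\<close>, \<open>sin (2\<pi>kx)\<close> with \<open>\<bar>k\<bar> \<le> N\<close>.\<close>

definition X_space :: "nat \<Rightarrow> (real \<Rightarrow> real) set" where
  "X_space N = {u. \<exists>a b :: int \<Rightarrow> real. u = (\<lambda>x. \<Sum>k\<in>{- int N..int N}.
       a k * cos (2 * pi * of_int k * x) + b k * sin (2 * pi * of_int k * x))}"

text \<open>Classical derivatives suffice: the Laplacian and the energy are only applied to
  trigonometric polynomials.\<close>

definition laplacian :: "(real \<Rightarrow> real) \<Rightarrow> real \<Rightarrow> real" where
  "laplacian u = deriv (deriv u)"

definition f_nl :: "real \<Rightarrow> real" where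
  "f_nl u = u ^ 3 - u"

definition energy :: "real \<Rightarrow> (real \<Rightarrow> real) \<Rightarrow> real" where
  "energy \<nu> u = (\<integral>x. 1/2 * \<nu> * \<bar>deriv u x\<bar>\<^sup>2 + 1/4 * ((u x)\<^sup>2 - 1)\<^sup>2 \<partial>torus)"

definition scheme_solution :: "real \<Rightarrow> real \<Rightarrow> nat \<Rightarrow> (nat \<Rightarrow> real \<Rightarrow> real) \<Rightarrow> bool" where
  "scheme_solution \<nu> \<tau> N u \<longleftrightarrow>
     (\<forall>n. u n \<in> X_space N) \<and>
     (\<forall>n x. (u (Suc n) x - u n x) / \<tau> =
        - \<nu> * laplacian (laplacian (u (Suc n))) x
        + laplacian (Pi_proj N (\<lambda>y. f_nl (u n y))) x)"

end

theory Submission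
  imports Defs "HOL-Probability.Probability_Measure"
begin

text \<open>
  Write \<open>a = u\<^sup>n\<close>, \<open>b = u\<^sup>n\<^sup>+\<^sup>1\<close>, \<open>w = b - a\<close> and \<open>\<lambda> = (2\<pi>k)\<^sup>2\<close> for the symbol of \<open>-\<Delta>\<close>. Testing the scheme
  with \<open>(-\<Delta>)\<^sup>-\<^sup>1w\<close>, that is, solving it for the Fourier coefficient of \<open>f(a)\<close> in every mode
  \<open>k \<noteq> 0\<close> and pairing with \<open>w\<close>, shows that the energy changes by

    \<open>- (\<Sum>k\<noteq>0. \<bar>w\<^sub>k\<bar>\<^sup>2 (1/(\<tau>\<lambda>) + \<nu>\<lambda>/2)) + \<integral> w\<^sup>2/4 (3a\<^sup>2 + 2ab + b\<^sup>2 - 2)\<close>,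

  where \<open>w\<^sub>k\<close> are the Fourier coefficients of \<open>w\<close> and the integrand is the Taylor remainder of the
  double well. The bracket is at least \<open>\<surd>(2\<nu>/\<tau>)\<close> by the arithmetic-geometric mean inequality, whatever the mode. If both \<open>\<bar>a\<bar>\<close> and \<open>\<bar>b\<bar>\<close>
  are at most \<open>K\<close> almost everywhere, the last integral is at most \<open>3/2 K\<^sup>2\<close> times the integral of
  \<open>w\<^sup>2\<close>, so the energy decreases as soon as \<open>3/2 K\<^sup>2 \<le> \<surd>(2\<nu>/\<tau>)\<close>
  (\<open>energy_step_decreasing\<close>).

  The amplitude bound comes from the energy itself. Solving the scheme for \<open>b\<close> gives the sum of a
  biharmonic resolvent applied to \<open>a\<close> and one applied to \<open>f(a)\<close> (\<open>scheme_step_resolvents\<close>). The two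
  assumed smoothing estimates bound these by the norms of \<open>a\<close> in \<open>L\<^sup>4\<close> and of \<open>f(a) = a(a\<^sup>2 - 1)\<close> in
  \<open>L\<^sup>4\<^sup>/\<^sup>3\<close>, and both norms are controlled by the energy of \<open>a\<close>, the second one through Hoelder's
  inequality. Hence an energy at most \<open>E\<^sub>0\<close> at one time gives a bound
  \<open>M = \<beta>\<^sub>1 (\<nu>\<tau>)\<^sup>-\<^sup>1\<^sup>/\<^sup>1\<^sup>6 + \<beta>\<^sub>2 \<tau> (\<nu>\<tau>)\<^sup>-\<^sup>1\<^sup>1\<^sup>/\<^sup>1\<^sup>6\<close> on the amplitude at the next time
  (\<open>scheme_step_sup_bound\<close>).

  The restrictions on \<open>\<tau>\<close> are chosen so that \<open>K = max L\<^sub>0 M\<close> is admissible, so induction on the time step,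
  carrying the mean, the energy bound and the amplitude bound along, proves the theorem. The
  quantity \<open>K\<close> does not grow with the number of steps, because \<open>M\<close> depends on the past only through
  the energy.
\<close>

section \<open>The step size restriction as a bound on amplitudes\<close>

text \<open>With \<open>c = 0.118\<close>, \<open>s = c\<^sup>3\<^sup>/\<^sup>1\<^sup>6\<close> and \<open>q = (\<nu>/\<tau>)\<^sup>1\<^sup>/\<^sup>4\<close>, the two restrictions on \<open>\<tau>\<close> are equivalent to bounds
  \<open>s q\<close> and \<open>s\<^sup>3 q\<close> on the two summands of \<open>M\<close>: the exponents \<open>16/3\<close> and \<open>16/9\<close> are the ones that
  make both scale like \<open>q\<close>. The value of \<open>c\<close> is then the largest number with three decimals for which
  \<open>3/2 (s + s\<^sup>3)\<^sup>2 \<le> \<surd>2\<close>.\<close>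

lemma step_size_imp_sup_threshold:
  fixes \<nu> \<tau> \<beta>1 \<beta>2 :: real
  assumes pos: "\<nu> > 0" "\<tau> > 0" "\<beta>1 > 0" "\<beta>2 > 0"
    and t1: "\<tau> \<le> 0.118 * \<nu> powr (5/3) * \<beta>1 powr (-16/3)"
    and t2: "\<tau> \<le> 0.118 * \<nu> powr (5/3) * \<beta>2 powr (-16/9)"
  defines "M \<equiv> \<beta>1 * (\<nu> * \<tau>) powr (-1/16) + \<beta>2 * \<tau> * (\<nu> * \<tau>) powr (-11/16)"
  shows "3 / 2 * M\<^sup>2 \<le> sqrt (2 * \<nu> / \<tau>)"
proof -
  define c :: real where "c = 0.118"
  define s where "s = c powr (3/16)"
  define q where "q = (\<nu> / \<tau>) powr (1/4)"
  have q_eq: "\<nu> powr (1/4) * \<tau> powr (-1/4) = q"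
    using pos by (simp add: q_def powr_divide powr_minus_divide)
  have c: "c > 0" by (simp add: c_def)
  have s0: "s > 0" and q0: "q > 0" using pos c by (auto simp: s_def q_def)
  have s_pow: "s ^ n = c powr (3 / 16 * n)" for n
    using c by (simp add: s_def powr_powr flip: powr_realpow)
  \<comment> \<open>The margin is thin: \<open>s + s\<^sup>3\<close> is about \<open>0.9704\<close>, and must stay below \<open>0.97098\<close>.\<close>
  have "s ^ 16 = c ^ 3"
    using c by (simp add: s_pow flip: powr_numeral)
  also have "\<dots> \<le> (0.67::real) ^ 16" by (simp add: c_def power_divide field_simps)
  finally have s: "s \<le> 0.67" using power_mono_iff [of s "0.67" 16] s0 by simp
  have A: "\<beta>1 * (\<nu> * \<tau>) powr (-1/16) \<le> s * q"
  proof -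
    have "\<tau> powr (3/16) \<le> (c * \<nu> powr (5/3) * \<beta>1 powr (-16/3)) powr (3/16)"
      using t1 pos unfolding c_def by (intro powr_mono2) auto
    also have "\<dots> = s * \<nu> powr (5/16) * inverse \<beta>1"
      using pos c by (simp add: s_def powr_mult powr_powr inverse_eq_divide)
    finally have "\<tau> powr (3/16) * \<beta>1 \<le> s * \<nu> powr (5/16)"
      using pos by (simp add: field_simps)
    then have "\<tau> powr (3/16) * \<beta>1 * (\<tau> powr (-1/4) * \<nu> powr (-1/16))
        \<le> s * \<nu> powr (5/16) * (\<tau> powr (-1/4) * \<nu> powr (-1/16))"
      by (rule mult_right_mono) simp
    also have "\<tau> powr (3/16) * \<beta>1 * (\<tau> powr (-1/4) * \<nu> powr (-1/16))
        = \<beta>1 * (\<nu> powr (-1/16) * (\<tau> powr (3/16) * \<tau> powr (-1/4)))" by simp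
    also have "\<dots> = \<beta>1 * (\<nu> * \<tau>) powr (-1/16)"
      using pos by (simp add: powr_mult flip: powr_add)
    also have "s * \<nu> powr (5/16) * (\<tau> powr (-1/4) * \<nu> powr (-1/16)) 
       = s * (\<nu> powr (5/16) * \<nu> powr (-1/16) * \<tau> powr (-1/4))" by simp
    also have "\<nu> powr (5/16) * \<nu> powr (-1/16) = \<nu> powr (1/4)"
      by (simp flip: powr_add)
    finally show ?thesis by (simp only: q_eq)
  qed
  have B: "\<beta>2 * \<tau> * (\<nu> * \<tau>) powr (-11/16) \<le> s ^ 3 * q"
  proof -
    have "\<tau> powr (9/16) \<le> (c * \<nu> powr (5/3) * \<beta>2 powr (-16/9)) powr (9/16)"
      using t2 pos unfolding c_def by (intro powr_mono2) auto
    also have "\<dots> = s ^ 3 * \<nu> powr (15/16) * inverse \<beta>2"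
      using pos c by (simp add: s_pow powr_mult powr_powr inverse_eq_divide)
    finally have "\<tau> powr (9/16) * \<beta>2 \<le> s ^ 3 * \<nu> powr (15/16)"
      using pos by (simp add: field_simps)
    then have "\<tau> powr (9/16) * \<beta>2 * (\<tau> powr (-1/4) * \<nu> powr (-11/16))
        \<le> s ^ 3 * \<nu> powr (15/16) * (\<tau> powr (-1/4) * \<nu> powr (-11/16))"
      by (rule mult_right_mono) simp
    also have "\<tau> powr (9/16) * \<beta>2 * (\<tau> powr (-1/4) * \<nu> powr (-11/16))
        = \<beta>2 * (\<nu> powr (-11/16) * (\<tau> powr (9/16) * \<tau> powr (-1/4)))" by simp
    also have "\<tau> powr (9/16) * \<tau> powr (-1/4) = \<tau> powr (1 + (-11/16))"
      by (simp flip: powr_add)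
    also have "\<dots> = \<tau> * \<tau> powr (-11/16)"
      using pos by (subst powr_add) simp
    also have "\<beta>2 * (\<nu> powr (-11/16) * (\<tau> * \<tau> powr (-11/16))) = \<beta>2 * \<tau> * (\<nu> * \<tau>) powr (-11/16)"
      using pos by (simp add: powr_mult)
    also have "s ^ 3 * \<nu> powr (15/16) * (\<tau> powr (-1/4) * \<nu> powr (-11/16)) 
       = s ^ 3 * (\<nu> powr (15/16) * \<nu> powr (-11/16) * \<tau> powr (-1/4))" by simp
    also have "\<nu> powr (15/16) * \<nu> powr (-11/16) = \<nu> powr (1/4)"
      by (simp flip: powr_add)
    finally show ?thesis by (simp only: q_eq)
  qed
  have "s ^ 3 \<le> 0.67 ^ 3" using s s0 by (intro power_mono) auto
  then have "s + s ^ 3 \<le> 0.9708" using s by (simp add: power3_eq_cube)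
  then have "M \<le> 0.9708 * q"
    using A B q0 mult_right_mono [of "s + s ^ 3" "0.9708" q] unfolding M_def by (simp add: distrib_right)
  moreover have "0 \<le> M" using pos by (simp add: M_def)
  ultimately have "M\<^sup>2 \<le> (0.9708 * q)\<^sup>2" by (intro power_mono) auto
  moreover have "q\<^sup>2 = sqrt (\<nu> / \<tau>)"
    using pos by (simp add: q_def powr_half_sqrt powr_powr flip: powr_numeral)
  ultimately have "M\<^sup>2 \<le> 0.9708\<^sup>2 * sqrt (\<nu> / \<tau>)"
    by (simp only: power_mult_distrib)
  then have "3 / 2 * M\<^sup>2 \<le> (3 / 2 * 0.9708\<^sup>2) * sqrt (\<nu> / \<tau>)"
    by simp
  also have "\<dots> \<le> sqrt 2 * sqrt (\<nu> / \<tau>)"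
    using pos by (intro mult_right_mono real_le_rsqrt) (auto simp: power_divide)
  finally show ?thesis by (simp flip: real_sqrt_mult)
qed

lemma step_size_imp_initial_threshold:
  fixes \<nu> \<tau> L :: real
  assumes "\<nu> > 0" "\<tau> > 0" "L \<noteq> 0" "\<tau> \<le> 8 * \<nu> / (9 * L ^ 4)"
  shows "3 / 2 * L\<^sup>2 \<le> sqrt (2 * \<nu> / \<tau>)"
proof (rule real_le_rsqrt)
  have "L ^ 4 > 0" using assms by (simp add: zero_less_power_eq)
  then have "9 * L ^ 4 * \<tau> \<le> 8 * \<nu>"
    using assms by (simp add: field_simps)
  then have "9 / 4 * L ^ 4 \<le> 2 * \<nu> / \<tau>"
    using assms by (simp add: field_simps)
  then show "(3 / 2 * L\<^sup>2)\<^sup>2 \<le> 2 * \<nu> / \<tau>"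
    by (simp add: power_mult_distrib power_divide flip: power_mult)
qed

section \<open>Characters and integration on the torus\<close>

text \<open>
  As a simplification rule, \<open>divide_minus_left\<close> would rewrite the end point \<open>-1/2\<close> inside \<^term>\<open>torus\<close>,
  after which facts stated for \<^term>\<open>torus\<close> would no longer match.
\<close>

declare divide_minus_left [simp del]

definition wave :: "int \<Rightarrow> real \<Rightarrow> complex" where
  "wave k x = exp (2 * of_real pi * \<i> * of_int k * of_real x)"

lemma wave_0 [simp]: "wave 0 x = 1" by (simp add: wave_def)

lemma wave_add: "wave (j + k) x = wave j x * wave k x"
  by (simp add: wave_def exp_add [symmetric] algebra_simps)

lemma cnj_wave [simp]: "cnj (wave k x) = wave (- k) x"
  by (simp add: wave_def exp_cnj)

lemma wave_Euler: "wave k x = Complex (cos (2 * pi * of_int k * x)) (sin (2 * pi * of_int k * x))"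
proof -
  have "wave k x = cis (2 * pi * of_int k * x)"
    by (simp add: wave_def cis_conv_exp mult_ac)
  then show ?thesis by (simp add: complex_eq_iff)
qed

lemma wave_periodic: "wave k (x + 1) = wave k x"
  by (auto simp: wave_def exp_eq algebra_simps)

lemma has_vector_derivative_wave [derivative_intros]:
  "(wave k has_vector_derivative 2 * of_real pi * \<i> * of_int k * wave k x) (at x within A)"
proof -
  have "((\<lambda>z. exp (2 * of_real pi * \<i> * of_int k * z)) has_field_derivative
          2 * of_real pi * \<i> * of_int k * wave k x) (at (of_real x))"
    unfolding wave_def by (auto intro!: derivative_eq_intros)
  from has_vector_derivative_real_field [OF this] 
  show ?thesis
    by (auto simp: wave_def [abs_def] intro: has_vector_derivative_at_within)
qed

lemma continuous_on_wave [continuous_intros]: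
  "continuous_on A g \<Longrightarrow> continuous_on A (\<lambda>x. wave k (g x))"
  unfolding wave_def by (intro continuous_intros)

lemma integrable_torus:
  fixes g :: "real \<Rightarrow> 'a::euclidean_space"
  assumes "continuous_on UNIV g"
  shows "integrable torus g"
proof -
  have "integrable (lebesgue_on {-1/2..1/2}) g"
    using continuous_imp_integrable_real continuous_on_subset [OF assms] by blast
  then have "set_integrable lebesgue {-1/2..1/2} g"
    by (subst (asm) integrable_restrict_space) (auto simp: set_integrable_def)
  then have "set_integrable lebesgue {-1/2..<1/2} g"
    by (rule set_integrable_subset) auto
  then show ?thesis
    by (subst integrable_restrict_space) (auto simp: set_integrable_def)
qed

lemma prob_space_torus: "prob_space torus"
  by (rule prob_spaceI) (simp add: emeasure_restrict_space)

text \<open>Orthonormality of the characters, from which all coefficient formulas follow; for \<open>k \<noteq> 0\<close> the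
  primitive is again a multiple of the periodic function \<^term>\<open>wave k\<close>.\<close>

lemma integral_wave: "(\<integral>x. wave k x \<partial>torus) = (if k = 0 then 1 else 0)"
proof (cases "k = 0")
  case True
  then show ?thesis using prob_space.prob_space [OF prob_space_torus] by simp
next
  case False
  define c :: complex where "c = 2 * of_real pi * \<i> * of_int k"
  have "c \<noteq> 0" using False by (simp add: c_def)
  let ?W = "\<lambda>x. wave k x / c"
  have "((\<lambda>x. wave k x * inverse c) has_vector_derivative c * wave k x * inverse c) (at x within A)" for x A
    unfolding c_def by (intro has_vector_derivative_mult_left has_vector_derivative_wave)
  moreover have "c * z * inverse c = z" for z
    using \<open>c \<noteq> 0\<close> by (simp add: field_simps)
  ultimately have W: "(?W has_vector_derivative wave k x) (at x within A)" for x A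
    by (simp only: divide_inverse)
  have "(wave k has_integral ?W (1/2) - ?W (-1/2)) {-1/2..1/2}"
    by (intro fundamental_theorem_of_calculus W) simp
  moreover have "?W (1/2) = ?W (-1/2)"
    using wave_periodic [of k "- 1 / 2"] by simp
  ultimately have "(wave k has_integral 0) {-1/2..1/2}" by simp
  \<comment> \<open>The fundamental theorem is about closed intervals; one end point is negligible.\<close>
  then have "(wave k has_integral 0) {-1/2..<1/2}"
    by (rule has_integral_spike_set_eq [THEN iffD1, rotated -1])
       (auto intro: negligible_subset [of "{1/2}"])
  then have "integral {-1/2..<1/2} (wave k) = 0"
    by (rule integral_unique)
  moreover have "integrable torus (wave k)"
    by (intro integrable_torus continuous_on_wave continuous_on_id)
  ultimately show ?thesis
    using False lebesgue_integral_eq_integral [of "{-1/2..<1/2}" "wave k"] by simp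
qed

section \<open>Trigonometric polynomials\<close>

text \<open>The coefficients are complex while \<open>u\<close> is real, so that \<open>c\<close> is forced to be Hermitian. Stating the
  expansion as an equation of complex numbers avoids carrying real parts through the computations.\<close>

definition trig_poly :: "nat \<Rightarrow> (int \<Rightarrow> complex) \<Rightarrow> (real \<Rightarrow> real) \<Rightarrow> bool" where
  "trig_poly N c u \<longleftrightarrow> (\<forall>x. of_real (u x) = (\<Sum>k\<in>{- int N..int N}. c k * wave k x))"

lemma trig_polyD: "trig_poly N c u \<Longrightarrow> of_real (u x) = (\<Sum>k\<in>{- int N..int N}. c k * wave k x)"
  by (simp add: trig_poly_def)

lemma trig_poly_cong: 
  assumes "trig_poly N c u" "\<And>k. \<bar>k\<bar> \<le> int N \<Longrightarrow> c k = d k"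
  shows "trig_poly N d u"
  using assms by (auto simp: trig_poly_def intro!: sum.cong)

lemma trig_poly_periodic: "trig_poly N c u \<Longrightarrow> u (x + 1) = u x"
  by (metis (no_types, lifting) of_real_eq_iff sum.cong trig_polyD wave_periodic)

lemma trig_poly_Re: "trig_poly N c u \<Longrightarrow> u x = Re (\<Sum>k\<in>{- int N..int N}. c k * wave k x)"
  by (metis Re_complex_of_real trig_polyD)

lemma trig_poly_continuous:
  assumes "trig_poly N c u"
  shows "continuous_on A u"
proof -
  have "u = (\<lambda>x. Re (\<Sum>k\<in>{- int N..int N}. c k * wave k x))"
    using trig_poly_Re [OF assms] by blast
  then show ?thesis by (auto intro!: continuous_intros)
qed

lemma trig_poly_diff:
  assumes "trig_poly N c u" "trig_poly N d v"
  shows "trig_poly N (\<lambda>k. c k - d k) (\<lambda>x. u x - v x)"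
  using assms by (simp add: trig_poly_def sum_subtractf algebra_simps)

lemma fourier_coeff_wave: "fourier_coeff g k = (\<integral>x. of_real (g x) * wave (- k) x \<partial>torus)"
  by (simp add: fourier_coeff_def wave_def mult_ac)

lemma cnj_fourier_coeff: "cnj (fourier_coeff g k) = fourier_coeff g (- k)"
proof -
  have "cnj (fourier_coeff g k) = (\<integral>x. cnj (of_real (g x) * wave (- k) x) \<partial>torus)"
    unfolding fourier_coeff_wave by (rule Bochner_Integration.integral_cnj [symmetric])
  then show ?thesis by (simp add: fourier_coeff_wave)
qed

lemma fourier_coeff_trig_poly:
  assumes "trig_poly N c u" and k: "\<bar>k\<bar> \<le> int N"
  shows "fourier_coeff u k = c k"
proof -
  have "fourier_coeff u k = (\<integral>x. (\<Sum>j\<in>{- int N..int N}. c j * wave (j - k) x) \<partial>torus)"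
    using wave_add [of _ "- k"]
    by (simp add: fourier_coeff_wave trig_polyD [OF assms(1)] sum_distrib_right mult.assoc)
  also have "\<dots> = (\<Sum>j\<in>{- int N..int N}. c j * (if j = k then 1 else 0))"
    by (subst Bochner_Integration.integral_sum)
       (auto intro!: integrable_torus continuous_intros simp: integral_wave)
  also have "\<dots> = c k" using k by (auto simp: if_distrib cong: if_cong)
  finally show ?thesis .
qed

lemma trig_poly_fourier_coeff:
  assumes "trig_poly N c u"
  shows "trig_poly N (fourier_coeff u) u"
  using fourier_coeff_trig_poly [OF assms] by (intro trig_poly_cong [OF assms]) simp

text \<open>Parseval's identity in the case where only one factor is band limited. It is needed for the pairing
  of the band-limited increment with \<open>f(u)\<close>, whose frequencies may exceed the band, and it explains
  why the truncation in the scheme does not disturb the energy balance.\<close>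

lemma integral_mult_trig_poly:
  assumes w: "trig_poly N c w" and g: "continuous_on UNIV g"
  shows "of_real (\<integral>x. g x * w x \<partial>torus) = (\<Sum>k\<in>{- int N..int N}. c k * cnj (fourier_coeff g k))"
proof -
  have "of_real (\<integral>x. g x * w x \<partial>torus) = 
        (\<integral>x. (\<Sum>k\<in>{- int N..int N}. c k * (of_real (g x) * wave k x)) \<partial>torus)"
    by (simp flip: integral_complex_of_real add: trig_polyD [OF w] sum_distrib_left mult.left_commute)
  also have "\<dots> = (\<Sum>k\<in>{- int N..int N}. c k * (\<integral>x. of_real (g x) * wave k x \<partial>torus))"
    using g by (subst Bochner_Integration.integral_sum)
       (auto intro!: integrable_torus continuous_intros)
  finally show ?thesis by (simp add: cnj_fourier_coeff) (simp add: fourier_coeff_wave)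
qed

lemma parseval_trig_poly:
  assumes "trig_poly N c u"
  shows "(\<integral>x. (u x)\<^sup>2 \<partial>torus) = (\<Sum>k\<in>{- int N..int N}. (cmod (c k))\<^sup>2)"
proof -
  have "complex_of_real (\<integral>x. (u x)\<^sup>2 \<partial>torus) = of_real (\<Sum>k\<in>{- int N..int N}. (cmod (c k))\<^sup>2)"
    unfolding power2_eq_square [of "u _"]
      integral_mult_trig_poly [OF assms trig_poly_continuous [OF assms]] of_real_sum
    by (intro sum.cong refl) (simp add: fourier_coeff_trig_poly [OF assms] abs_le_iff complex_norm_square del: of_real_power)
  then show ?thesis using of_real_eq_iff by blast
qed

lemma trig_poly_deriv:
  assumes "trig_poly N c u"
  defines "d \<equiv> (\<lambda>k. 2 * of_real pi * \<i> * of_int k * c k)"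
  shows "trig_poly N d (deriv u)"
proof (unfold trig_poly_def, rule allI)
  fix x
  let ?S = "\<Sum>k\<in>{- int N..int N}. d k * wave k x"
  have "((\<lambda>x. \<Sum>k\<in>{- int N..int N}. c k * wave k x) has_vector_derivative ?S) (at x)"
    by (auto intro!: derivative_eq_intros simp: d_def mult_ac)
  then have D: "((\<lambda>x. of_real (u x) :: complex) has_vector_derivative ?S) (at x)"
    by (simp add: trig_polyD [OF assms(1)])
  have "(u has_real_derivative Re ?S) (at x)"
    using bounded_linear.has_vector_derivative [OF bounded_linear_Re D]
    by (simp add: has_real_derivative_iff_has_vector_derivative)
  \<comment> \<open>Differentiating the vanishing imaginary part shows that the formal derivative is real.\<close>
  moreover have "((\<lambda>x. 0) has_real_derivative Im ?S) (at x)"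
    using bounded_linear.has_vector_derivative [OF bounded_linear_Im D]
    by (simp add: has_real_derivative_iff_has_vector_derivative)
  ultimately have "deriv u x = Re ?S" "Im ?S = 0"
    using DERIV_imp_deriv DERIV_unique [OF _ DERIV_const] by blast+
  then show "of_real (deriv u x) = ?S"
    by (simp add: complex_eq_iff)
qed

lemma trig_poly_laplacian:
  assumes "trig_poly N c u"
  shows "trig_poly N (\<lambda>k. - of_real ((2 * pi * of_int k)\<^sup>2) * c k) (laplacian u)"
  unfolding laplacian_def
  by (rule trig_poly_cong [OF trig_poly_deriv [OF trig_poly_deriv [OF assms]]])
     (simp add: power2_eq_square algebra_simps)

text \<open>Each pair of terms \<open>a cos + b sin\<close> is \<open>p e\<^sub>k + p\<^sup>* e\<^sub>-\<^sub>k\<close> with \<open>p = (a - ib)/2\<close>; collecting the frequency \<open>k\<close>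
  means adding the contributions of the indices \<open>k\<close> and \<open>-k\<close>.\<close>

lemma X_space_trig_poly:
  assumes "u \<in> X_space N"
  shows "trig_poly N (fourier_coeff u) u"
proof -
  from assms obtain a b :: "int \<Rightarrow> real" where u: "u = (\<lambda>x. \<Sum>k\<in>{- int N..int N}.
       a k * cos (2 * pi * of_int k * x) + b k * sin (2 * pi * of_int k * x))"
    by (auto simp: X_space_def)
  define p :: "int \<Rightarrow> complex" where "p k = (a k - \<i> * b k) / 2" for k
  have "of_real (u x) = (\<Sum>k\<in>{- int N..int N}. (p k + cnj (p (- k))) * wave k x)" for x
  proof -
    have "of_real (u x) = (\<Sum>k\<in>{- int N..int N}. p k * wave k x + cnj (p k) * wave (- k) x)"
      unfolding u of_real_sum
      by (intro sum.cong) (auto simp: p_def wave_Euler complex_eq_iff diff_divide_distrib)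
    also have "\<dots> = (\<Sum>k\<in>{- int N..int N}. p k * wave k x) 
                    + (\<Sum>k\<in>{- int N..int N}. cnj (p k) * wave (- k) x)"
      by (rule sum.distrib)
    also have "(\<Sum>k\<in>{- int N..int N}. cnj (p k) * wave (- k) x) 
             = (\<Sum>k\<in>{- int N..int N}. cnj (p (- k)) * wave k x)"
      by (rule sum.reindex_bij_witness [of _ uminus uminus]) auto
    finally show ?thesis by (simp add: sum.distrib algebra_simps)
  qed
  then have "trig_poly N (\<lambda>k. p k + cnj (p (- k))) u"
    by (simp add: trig_poly_def)
  then show ?thesis by (rule trig_poly_fourier_coeff)
qed

text \<open>If the product of the symbol and the coefficients vanishes outside the band, then the infinite sum
  is finite, and the evenness of the symbol makes it real.\<close>

lemma trig_poly_fourier_multiplier_band: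
  assumes "\<And>k. \<bar>k\<bar> > int N \<Longrightarrow> of_real (m k) * fourier_coeff g k = 0" and "\<And>k. m (- k) = m k"
  shows "trig_poly N (\<lambda>k. m k * fourier_coeff g k) (fourier_multiplier m g)"
proof (unfold trig_poly_def, rule allI)
  fix x
  let ?S = "\<Sum>k\<in>{- int N..int N}. m k * fourier_coeff g k * wave k x"
  have "fourier_multiplier m g x = Re (\<Sum>\<^sub>\<infinity>k\<in>{- int N..int N}. m k * fourier_coeff g k * wave k x)"
    unfolding fourier_multiplier_def wave_def [symmetric]
    using assms(1) by (intro arg_cong [of _ _ Re] infsum_cong_neutral) force+
  then have "fourier_multiplier m g x = Re ?S" by simp
  moreover have "cnj ?S = ?S"
    using assms(2) by (simp add: cnj_fourier_coeff)
       (rule sum.reindex_bij_witness [of _ uminus uminus], auto)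
  ultimately show "of_real (fourier_multiplier m g x) = ?S"
    by (metis Reals_cnj_iff of_real_Re)
qed

lemma trig_poly_Pi_proj: "trig_poly N (fourier_coeff g) (Pi_proj N g)"
  unfolding Pi_proj_def
  by (rule trig_poly_cong [OF trig_poly_fourier_multiplier_band]) auto

lemma fourier_coeff_trig_poly_eq_0:
  assumes "trig_poly N c u" and k: "\<bar>k\<bar> > int N"
  shows "fourier_coeff u k = 0"
proof -
  let ?M = "nat \<bar>k\<bar>"
  \<comment> \<open>A trigonometric polynomial of degree \<open>N\<close> is one of degree \<open>\<bar>k\<bar>\<close> with zero coefficients added.\<close>
  have "trig_poly ?M (\<lambda>j. if \<bar>j\<bar> \<le> int N then c j else 0) u"
    using k unfolding trig_poly_def trig_polyD [OF assms(1)]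
    by (auto intro!: sum.mono_neutral_cong_left)
  from fourier_coeff_trig_poly [OF this, of k] show ?thesis using k by simp
qed

lemma trig_poly_fourier_multiplier:
  assumes "trig_poly N c u" and "\<And>k. m (- k) = m k"
  shows "trig_poly N (\<lambda>k. of_real (m k) * c k) (fourier_multiplier m u)"
  using fourier_coeff_trig_poly_eq_0 [OF assms(1)] 
  by (intro trig_poly_cong [OF trig_poly_fourier_multiplier_band [where m = m, OF _ assms(2)]])
     (auto simp: fourier_coeff_trig_poly [OF assms(1)])

lemma trig_poly_unique:
  assumes "trig_poly N c u" "trig_poly N d u" "\<bar>k\<bar> \<le> int N"
  shows "c k = d k"
  using assms fourier_coeff_trig_poly by metis

lemma trig_poly_add:
  assumes "trig_poly N c u" "trig_poly N d v"
  shows "trig_poly N (\<lambda>k. c k + d k) (\<lambda>x. u x + v x)"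
  using assms by (simp add: trig_poly_def sum.distrib algebra_simps)

lemma trig_poly_scale:
  assumes "trig_poly N c u"
  shows "trig_poly N (\<lambda>k. of_real r * c k) (\<lambda>x. r * u x)"
  using assms by (simp add: trig_poly_def sum_distrib_left mult.assoc)

section \<open>One step of the scheme in Fourier variables\<close>

text \<open>The scheme, read off mode by mode. The projection disappears, since only the modes of the band
  enter, and the fourth-order operator acts as multiplication by a number.\<close>

definition scheme_step :: "real \<Rightarrow> real \<Rightarrow> nat \<Rightarrow> (real \<Rightarrow> real) \<Rightarrow> (real \<Rightarrow> real) \<Rightarrow> bool" where
  "scheme_step \<nu> \<tau> N a b \<longleftrightarrow>
     trig_poly N (fourier_coeff a) a \<and> trig_poly N (fourier_coeff b) b \<and>
     (\<forall>k. \<bar>k\<bar> \<le> int N \<longrightarrow>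
        (fourier_coeff b k - fourier_coeff a k) / of_real \<tau> =
          - of_real (\<nu> * ((2 * pi * of_int k)\<^sup>2)\<^sup>2) * fourier_coeff b k
          - of_real ((2 * pi * of_int k)\<^sup>2) * fourier_coeff (\<lambda>x. f_nl (a x)) k)"

text \<open>Both sides of the scheme are trigonometric polynomials, so their coefficients agree.\<close>

lemma scheme_solution_step:
  assumes "scheme_solution \<nu> \<tau> N u"
  shows "scheme_step \<nu> \<tau> N (u n) (u (Suc n))"
proof -
  let ?a = "fourier_coeff (u n)" and ?b = "fourier_coeff (u (Suc n))"
  let ?f = "fourier_coeff (\<lambda>x. f_nl (u n x))"
  have ab: "trig_poly N ?a (u n)" "trig_poly N ?b (u (Suc n))"
    using assms by (auto simp: scheme_solution_def intro: X_space_trig_poly)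
  have "trig_poly N (\<lambda>k. of_real (1 / \<tau>) * (?b k - ?a k)) (\<lambda>x. 1 / \<tau> * (u (Suc n) x - u n x))"
    by (intro trig_poly_scale trig_poly_diff ab)
  moreover have "(\<lambda>x. 1 / \<tau> * (u (Suc n) x - u n x)) =
      (\<lambda>x. (- \<nu>) * laplacian (laplacian (u (Suc n))) x
        + laplacian (Pi_proj N (\<lambda>y. f_nl (u n y))) x)"
    using assms by (auto simp: scheme_solution_def)
  ultimately have lhs: "trig_poly N (\<lambda>k. of_real (1 / \<tau>) * (?b k - ?a k))
      (\<lambda>x. (- \<nu>) * laplacian (laplacian (u (Suc n))) x
        + laplacian (Pi_proj N (\<lambda>y. f_nl (u n y))) x)"
    by simp
  note rhs = trig_poly_add [OF trig_poly_scale [OF trig_poly_laplacian [OF trig_poly_laplacian [OF ab(2)]]]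
      trig_poly_laplacian [OF trig_poly_Pi_proj], of "- \<nu>" "\<lambda>y. f_nl (u n y)"]
  show ?thesis
    unfolding scheme_step_def
    using ab trig_poly_unique [OF lhs rhs]
    by (simp add: power2_eq_square [of "_ ^ 2"] mult.assoc)
qed

lemma fourier_coeff_0: "fourier_coeff g 0 = of_real (\<integral>x. g x \<partial>torus)"
  by (simp add: fourier_coeff_wave)

lemma mean_zero_iff: "mean_zero g \<longleftrightarrow> fourier_coeff g 0 = 0"
  by (simp add: mean_zero_def fourier_coeff_0)

text \<open>The right-hand side of the scheme consists of derivatives, so it has no zero mode.\<close>

lemma scheme_step_mean_zero:
  assumes "scheme_step \<nu> \<tau> N a b" "\<tau> > 0" "mean_zero a"
  shows "mean_zero b"
proof -
  have "(fourier_coeff b 0 - fourier_coeff a 0) / of_real \<tau> = 0"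
    using assms(1) unfolding scheme_step_def by (metis (no_types, lifting) abs_0 diff_zero
      mult_zero_left mult_zero_right of_int_0 of_nat_0_le_iff of_real_0 power_zero_numeral minus_zero)
  then show ?thesis using assms by (simp add: mean_zero_iff)
qed

text \<open>Every mode of the implicit scheme is a scalar linear equation for \<open>b\<close> whose coefficient
  \<open>1 + \<nu>\<tau>\<lambda>\<^sup>2\<close> is positive.\<close>

lemma scheme_step_resolvents:
  assumes "scheme_step \<nu> \<tau> N a b" "\<nu> > 0" "\<tau> > 0"
  shows "b x = biharm_resolvent \<nu> \<tau> a x
             + lap_biharm_resolvent \<nu> \<tau> (Pi_proj N (\<lambda>x. f_nl (a x))) x"
proof -
  let ?a = "fourier_coeff a" and ?b = "fourier_coeff b" and ?f = "fourier_coeff (\<lambda>x. f_nl (a x))"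
  define R where "R k = inverse (1 + \<nu> * \<tau> * (2 * pi * \<bar>real_of_int k\<bar>) ^ 4)" for k
  define S where "S k = - \<tau> * (2 * pi * \<bar>real_of_int k\<bar>)\<^sup>2 * R k" for k
  note * = assms(1) [unfolded scheme_step_def]
  have R: "trig_poly N (\<lambda>k. of_real (R k) * ?a k) (biharm_resolvent \<nu> \<tau> a)"
    unfolding biharm_resolvent_def R_def
    by (rule trig_poly_fourier_multiplier) (use * in auto)
  have S: "trig_poly N (\<lambda>k. of_real (S k) * ?f k)
      (lap_biharm_resolvent \<nu> \<tau> (Pi_proj N (\<lambda>x. f_nl (a x))))"
    unfolding lap_biharm_resolvent_def S_def R_def
    by (rule trig_poly_fourier_multiplier [OF trig_poly_Pi_proj]) auto
  have "of_real (R k) * ?a k + of_real (S k) * ?f k = ?b k" if "\<bar>k\<bar> \<le> int N" for k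
  proof -
    define l where "l = (2 * pi * real_of_int k)\<^sup>2"
    have "(2 * pi * \<bar>real_of_int k\<bar>)\<^sup>2 = l" "(2 * pi * \<bar>real_of_int k\<bar>) ^ 4 = l\<^sup>2"
      by (auto simp: l_def power_mult_distrib simp flip: power_mult)
    then have RS: "R k = inverse (1 + \<nu> * \<tau> * l\<^sup>2)" "S k = - \<tau> * l * R k"
      by (auto simp: R_def S_def)
    have pos: "1 + \<nu> * \<tau> * l\<^sup>2 > 0" using assms by (intro add_pos_nonneg) auto
    have "(?b k - ?a k) / of_real \<tau> = - of_real (\<nu> * l\<^sup>2) * ?b k - of_real l * ?f k"
      using * that unfolding l_def by blast
    then have "?a k - of_real (\<tau> * l) * ?f k = of_real (1 + \<nu> * \<tau> * l\<^sup>2) * ?b k"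
      using \<open>\<tau> > 0\<close> by (simp add: field_simps)
    then have "of_real (R k) * (?a k - of_real (\<tau> * l) * ?f k) = ?b k"
      using pos unfolding RS(1) by (metis (no_types, lifting) left_inverse less_irrefl mult.assoc mult_1 of_real_1 of_real_mult)
    then show ?thesis by (simp add: RS(2) algebra_simps)
  qed
  then have "trig_poly N ?b (\<lambda>x. biharm_resolvent \<nu> \<tau> a x
             + lap_biharm_resolvent \<nu> \<tau> (Pi_proj N (\<lambda>x. f_nl (a x))) x)"
    by (rule trig_poly_cong [OF trig_poly_add [OF R S]])
  then show ?thesis
    using * unfolding trig_poly_def by (metis of_real_eq_iff)
qed

section \<open>The energy balance of one step\<close>

text \<open>The \<open>H\<^sup>-\<^sup>1\<close> dissipation of the time difference and the \<open>H\<^sup>1\<close> dissipation of the implicit term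
  interpolate to \<open>L\<^sup>2\<close> with a constant independent of the frequency \<open>\<surd>l\<close>.\<close>

lemma AM_GM_symbol:
  assumes "\<nu> > 0" "\<tau> > 0" "l > 0"
  shows "sqrt (2 * \<nu> / \<tau>) \<le> 1 / (\<tau> * l) + \<nu> * l / 2"
proof -
  have "sqrt ((2 / (\<tau> * l)) * (\<nu> * l)) \<le> (2 / (\<tau> * l) + \<nu> * l) / 2"
    by (rule arith_geo_mean_sqrt) (use assms in auto)
  then show ?thesis using assms by (simp add: field_simps)
qed

lemma Re_diff_mult_cnj:
  "Re ((b - a) * cnj b) = ((cmod b)\<^sup>2 - (cmod a)\<^sup>2 + (cmod (b - a))\<^sup>2) / 2"
  unfolding cmod_power2 by (simp add: power2_eq_square field_simps)

text \<open>The contribution of a single mode to the balance of gradient energy and linearised potential. For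
  \<open>l > 0\<close> the scheme determines \<open>f\<close>; substituting it, the cross term \<open>Re ((b - a) b\<^sup>*)\<close> cancels the change
  of gradient energy and leaves dissipation. For \<open>l = 0\<close> the scheme forces \<open>a = b\<close>.\<close>

lemma mode_energy_le:
  fixes a b f :: complex
  assumes "\<nu> > 0" "\<tau> > 0" "l \<ge> 0"
    and step: "(b - a) / of_real \<tau> = - of_real (\<nu> * l\<^sup>2) * b - of_real l * f"
  shows "\<nu> / 2 * (l * (cmod b)\<^sup>2 - l * (cmod a)\<^sup>2) + Re ((b - a) * cnj f)
           \<le> - sqrt (2 * \<nu> / \<tau>) * (cmod (b - a))\<^sup>2"
proof (cases "l = 0")
  case True
  then show ?thesis using step \<open>\<tau> > 0\<close> by simp
next
  case False
  have f: "f = - (of_real (1 / (\<tau> * l)) * (b - a) + of_real (\<nu> * l) * b)"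
    using False \<open>\<tau> > 0\<close> step by (simp add: field_simps power2_eq_square)
  have Re_pair: "Re (z * cnj (- (of_real p * v + of_real q * w))) 
      = - (p * Re (z * cnj v)) - q * Re (z * cnj w)" for p q z v w
    by (simp add: algebra_simps)
  have "Re ((b - a) * cnj f)
      = - (1 / (\<tau> * l) * Re ((b - a) * cnj (b - a))) - \<nu> * l * Re ((b - a) * cnj b)"
    unfolding f by (rule Re_pair)
  also have "Re ((b - a) * cnj (b - a)) = (cmod (b - a))\<^sup>2"
    by (metis Re_complex_of_real complex_norm_square)
  also have "Re ((b - a) * cnj b) = ((cmod b)\<^sup>2 - (cmod a)\<^sup>2 + (cmod (b - a))\<^sup>2) / 2"
    by (rule Re_diff_mult_cnj)
  finally have "Re ((b - a) * cnj f) = - (1 / (\<tau> * l) * (cmod (b - a))\<^sup>2)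
      - \<nu> * l * (((cmod b)\<^sup>2 - (cmod a)\<^sup>2 + (cmod (b - a))\<^sup>2) / 2)" .
  then have "\<nu> / 2 * (l * (cmod b)\<^sup>2 - l * (cmod a)\<^sup>2) + Re ((b - a) * cnj f) =
      - ((1 / (\<tau> * l) + \<nu> * l / 2) * (cmod (b - a))\<^sup>2)"
    by (simp add: algebra_simps add_divide_distrib diff_divide_distrib)
  moreover have "sqrt (2 * \<nu> / \<tau>) * (cmod (b - a))\<^sup>2 \<le> (1 / (\<tau> * l) + \<nu> * l / 2) * (cmod (b - a))\<^sup>2"
    using AM_GM_symbol [of \<nu> \<tau> l] assms False by (intro mult_right_mono) auto
  ultimately show ?thesis by (simp only: mult_minus_left neg_le_iff_le)
qed

lemma energy_trig_poly:
  assumes "trig_poly N c u"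
  shows "energy \<nu> u = \<nu> / 2 * (\<Sum>k\<in>{- int N..int N}. (2 * pi * of_int k)\<^sup>2 * (cmod (c k))\<^sup>2)
                      + (\<integral>x. 1/4 * ((u x)\<^sup>2 - 1)\<^sup>2 \<partial>torus)"
proof -
  note du = trig_poly_deriv [OF assms]
  have "energy \<nu> u = (\<integral>x. \<nu> / 2 * (deriv u x)\<^sup>2 + 1/4 * ((u x)\<^sup>2 - 1)\<^sup>2 \<partial>torus)"
    by (simp add: energy_def mult_ac)
  also have "\<dots> = \<nu> / 2 * (\<integral>x. (deriv u x)\<^sup>2 \<partial>torus) + (\<integral>x. 1/4 * ((u x)\<^sup>2 - 1)\<^sup>2 \<partial>torus)"
    by (subst Bochner_Integration.integral_add)
       (auto intro!: integrable_torus continuous_intros trig_poly_continuous [OF du]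
          trig_poly_continuous [OF assms])
  finally show ?thesis
    by (simp add: parseval_trig_poly [OF du] norm_mult power_mult_distrib)
qed

text \<open>Exact Taylor expansion of the double well; \<^const>\<open>f_nl\<close> is its derivative. The remainder is quadratic
  in the increment, so it can be absorbed by the dissipation when \<open>a\<close> and \<open>b\<close> are bounded.\<close>

lemma double_well_taylor:
  "1/4 * (b\<^sup>2 - 1)\<^sup>2 - 1/4 * (a\<^sup>2 - 1)\<^sup>2
     = f_nl a * (b - a) + (b - a)\<^sup>2 / 4 * (3 * a\<^sup>2 + 2 * a * b + b\<^sup>2 - 2)"
  by (simp add: f_nl_def field_simps power2_eq_square power3_eq_cube)

lemma continuous_on_f_nl [continuous_intros]:
  "continuous_on A g \<Longrightarrow> continuous_on A (\<lambda>x. f_nl (g x))"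
  unfolding f_nl_def by (intro continuous_intros)

text \<open>The gradient part of the energy is a sum over modes by Parseval; the potential part is
  expanded by \<open>double_well_taylor\<close>, and its linear term is a sum over the same modes. The estimate
  \<open>mode_energy_le\<close> applies to each summand.\<close>

lemma energy_step_le:
  assumes "scheme_step \<nu> \<tau> N a b" "\<nu> > 0" "\<tau> > 0"
  shows "energy \<nu> b - energy \<nu> a \<le>
           (\<integral>x. (b x - a x)\<^sup>2 / 4 * (3 * (a x)\<^sup>2 + 2 * a x * b x + (b x)\<^sup>2 - 2) \<partial>torus)
           - sqrt (2 * \<nu> / \<tau>) * (\<integral>x. (b x - a x)\<^sup>2 \<partial>torus)"
proof -
  let ?a = "fourier_coeff a" and ?b = "fourier_coeff b" and ?f = "fourier_coeff (\<lambda>x. f_nl (a x))"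
  let ?I = "{- int N..int N}" and ?l = "\<lambda>k. (2 * pi * real_of_int k)\<^sup>2"
  from assms(1) have a: "trig_poly N ?a a" and b: "trig_poly N ?b b" 
    and step: "\<And>k. \<bar>k\<bar> \<le> int N \<Longrightarrow> (?b k - ?a k) / of_real \<tau>
                 = - of_real (\<nu> * (?l k)\<^sup>2) * ?b k - of_real (?l k) * ?f k"
    by (auto simp: scheme_step_def)
  note w = trig_poly_diff [OF b a]
  note cont = trig_poly_continuous [OF a] trig_poly_continuous [OF b]
  have "(\<integral>x. 1/4 * ((b x)\<^sup>2 - 1)\<^sup>2 \<partial>torus) - (\<integral>x. 1/4 * ((a x)\<^sup>2 - 1)\<^sup>2 \<partial>torus) =
      (\<integral>x. 1/4 * ((b x)\<^sup>2 - 1)\<^sup>2 - 1/4 * ((a x)\<^sup>2 - 1)\<^sup>2 \<partial>torus)"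
    by (intro Bochner_Integration.integral_diff [symmetric] integrable_torus continuous_intros cont)
  also have "\<dots> = (\<integral>x. f_nl (a x) * (b x - a x) \<partial>torus) + 
      (\<integral>x. (b x - a x)\<^sup>2 / 4 * (3 * (a x)\<^sup>2 + 2 * a x * b x + (b x)\<^sup>2 - 2) \<partial>torus)" (is "_ = ?F + ?R")
    unfolding double_well_taylor
    by (intro Bochner_Integration.integral_add integrable_torus continuous_intros cont) auto
  finally have well: "(\<integral>x. 1/4 * ((b x)\<^sup>2 - 1)\<^sup>2 \<partial>torus) - (\<integral>x. 1/4 * ((a x)\<^sup>2 - 1)\<^sup>2 \<partial>torus) = ?F + ?R" .
  have "complex_of_real ?F = (\<Sum>k\<in>?I. (?b k - ?a k) * cnj (?f k))"
    by (rule integral_mult_trig_poly [OF w]) (intro continuous_intros cont)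
  then have F: "?F = (\<Sum>k\<in>?I. Re ((?b k - ?a k) * cnj (?f k)))"
    by (drule_tac arg_cong [of _ _ Re]) (simp only: Re_complex_of_real Re_sum)
  have "energy \<nu> b - energy \<nu> a = 
      (\<Sum>k\<in>?I. \<nu> / 2 * (?l k * (cmod (?b k))\<^sup>2 - ?l k * (cmod (?a k))\<^sup>2) + Re ((?b k - ?a k) * cnj (?f k))) + ?R"
    using well unfolding energy_trig_poly [OF a] energy_trig_poly [OF b] F
    by (simp add: sum.distrib sum_subtractf sum_distrib_left right_diff_distrib)
  also have "\<dots> \<le> (\<Sum>k\<in>?I. - sqrt (2 * \<nu> / \<tau>) * (cmod (?b k - ?a k))\<^sup>2) + ?R"
    by (intro add_right_mono sum_mono mode_energy_le step) (use assms in auto)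
  also have "\<dots> = ?R - sqrt (2 * \<nu> / \<tau>) * (\<integral>x. (b x - a x)\<^sup>2 \<partial>torus)"
    unfolding parseval_trig_poly [OF w] sum_distrib_left [symmetric] by simp
  finally show ?thesis .
qed

text \<open>If both amplitudes are at most \<open>K\<close>, then \<open>3a\<^sup>2 + 2ab + b\<^sup>2 \<le> 4a\<^sup>2 + 2b\<^sup>2 \<le> 6K\<^sup>2\<close>, and a quarter of this is
  the threshold.\<close>

lemma energy_step_decreasing:
  assumes "scheme_step \<nu> \<tau> N a b" "\<nu> > 0" "\<tau> > 0"
    and "AE x in torus. \<bar>a x\<bar> \<le> K" "AE x in torus. \<bar>b x\<bar> \<le> K"
    and K: "3 / 2 * K\<^sup>2 \<le> sqrt (2 * \<nu> / \<tau>)"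
  shows "energy \<nu> b \<le> energy \<nu> a"
proof -
  from assms(1) have "trig_poly N (fourier_coeff a) a" "trig_poly N (fourier_coeff b) b" 
    by (auto simp: scheme_step_def)
  note cont = this [THEN trig_poly_continuous]
  have "(\<integral>x. (b x - a x)\<^sup>2 / 4 * (3 * (a x)\<^sup>2 + 2 * a x * b x + (b x)\<^sup>2 - 2) \<partial>torus)
      \<le> (\<integral>x. sqrt (2 * \<nu> / \<tau>) * (b x - a x)\<^sup>2 \<partial>torus)"
  proof (rule integral_mono_AE)
    show "AE x in torus. (b x - a x)\<^sup>2 / 4 * (3 * (a x)\<^sup>2 + 2 * a x * b x + (b x)\<^sup>2 - 2)
        \<le> sqrt (2 * \<nu> / \<tau>) * (b x - a x)\<^sup>2"
      using assms(4,5)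
    proof eventually_elim
      case (elim x)
      have "(a x)\<^sup>2 \<le> K\<^sup>2" "(b x)\<^sup>2 \<le> K\<^sup>2"
        using elim abs_le_square_iff by force+
      moreover have "2 * a x * b x \<le> (a x)\<^sup>2 + (b x)\<^sup>2" by (rule sum_squares_bound)
      ultimately have "(3 * (a x)\<^sup>2 + 2 * a x * b x + (b x)\<^sup>2 - 2) / 4 \<le> sqrt (2 * \<nu> / \<tau>)"
        using K by simp
      from mult_right_mono [OF this zero_le_power2 [of "b x - a x"]]
      show ?case by (simp add: mult_ac)
    qed
  qed (auto intro!: integrable_torus continuous_intros cont)
  then show ?thesis using energy_step_le [OF assms(1-3)] by simp
qed

section \<open>Lebesgue norms controlled by the energy\<close>

lemma Linf_norm_imp_AE:
  assumes "Linf_norm g \<le> ereal c"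
  shows "AE x in torus. \<bar>g x\<bar> \<le> c"
  using esssup_AE [of "\<lambda>x. ereal \<bar>g x\<bar>" torus]
proof eventually_elim
  case (elim x)
  then have "ereal \<bar>g x\<bar> \<le> ereal c"
    using assms unfolding Linf_norm_def by (rule order_trans)
  then show ?case by simp
qed

lemma powr_4_abs: "\<bar>x\<bar> powr 4 = x ^ 4" for x :: real
  by (cases "x = 0") (auto simp: power_even_abs)

lemma powr_2_abs: "\<bar>x\<bar> powr 2 = x\<^sup>2" for x :: real
  by (cases "x = 0") auto

text \<open>With \<open>v = u\<^sup>2 - 1\<close> one has \<open>u\<^sup>4 = v\<^sup>2 + 2v + 1\<close>. The integral of \<open>v\<^sup>2\<close> is at most \<open>4E\<close>, and the mean of \<open>v\<close>
  is at most the root of this number because a variance is nonnegative.\<close>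

lemma integral_pow4_le:
  assumes u: "continuous_on UNIV u" and E: "(\<integral>x. 1/4 * ((u x)\<^sup>2 - 1)\<^sup>2 \<partial>torus) \<le> E"
  shows "(\<integral>x. (u x) ^ 4 \<partial>torus) \<le> (1 + 2 * sqrt E)\<^sup>2"
proof -
  interpret prob_space torus by (rule prob_space_torus)
  define v where "v x = (u x)\<^sup>2 - 1" for x
  have v: "continuous_on UNIV v"
    unfolding v_def by (intro continuous_intros u)
  define m where "m = (\<integral>x. v x \<partial>torus)"
  define s where "s = (\<integral>x. (v x)\<^sup>2 \<partial>torus)"
  have "0 \<le> (\<integral>x. (v x - m)\<^sup>2 \<partial>torus)" by simp
  also have "\<dots> = s - m\<^sup>2"
    unfolding m_def s_def
    by (rule variance_eq) (intro integrable_torus continuous_intros v)+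
  finally have "m\<^sup>2 \<le> s" by simp
  moreover have s: "s \<le> 4 * E"
    using E by (simp add: s_def v_def)
  ultimately have "\<bar>m\<bar> \<le> sqrt (4 * E)"
    using real_le_rsqrt real_sqrt_le_mono by (metis order_trans real_sqrt_abs)
  also have "\<dots> = 2 * sqrt E" by (simp add: real_sqrt_mult)
  finally have m: "m \<le> 2 * sqrt E" by simp
  have "0 \<le> s" by (simp add: s_def)
  then have "0 \<le> E" using s by simp
  have "(\<integral>x. (u x) ^ 4 \<partial>torus) = (\<integral>x. ((v x)\<^sup>2 + 2 * v x) + 1 \<partial>torus)"
    by (rule Bochner_Integration.integral_cong) (auto simp: v_def power2_eq_square power4_eq_xxxx algebra_simps)
  also have "\<dots> = (s + 2 * m) + 1"
    unfolding s_def m_def using prob_space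
    by (subst Bochner_Integration.integral_add, (intro integrable_torus continuous_intros v)+)+ simp
  also have "\<dots> \<le> (1 + 2 * sqrt E)\<^sup>2"
    using m s \<open>0 \<le> E\<close> by (simp add: power2_sum power_mult_distrib)
  finally show ?thesis .
qed

lemma Lp_continuous:
  assumes "periodic1 g" "continuous_on UNIV g" "p > 0"
  shows "g \<in> Lp p"
proof -
  have "g \<in> borel_measurable torus"
    using integrable_torus [OF assms(2)] by (rule borel_measurable_integrable)
  moreover have "integrable torus (\<lambda>x. \<bar>g x\<bar> powr p)"
    using assms by (intro integrable_torus continuous_on_powr' continuous_intros) auto
  ultimately show ?thesis using assms by (simp add: Lp_def)
qed

lemma Lp_norm_4_le:
  assumes u: "continuous_on UNIV u" and E: "(\<integral>x. 1/4 * ((u x)\<^sup>2 - 1)\<^sup>2 \<partial>torus) \<le> E"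
  shows "Lp_norm 4 u \<le> sqrt (1 + 2 * sqrt E)"
proof -
  have "0 \<le> (\<integral>x. 1/4 * ((u x)\<^sup>2 - 1)\<^sup>2 \<partial>torus)" by simp
  then have "0 \<le> E" using E by linarith
  have "Lp_norm 4 u = (\<integral>x. (u x) ^ 4 \<partial>torus) powr (1 / 4)"
    by (simp add: Lp_norm_def powr_4_abs)
  also have "\<dots> \<le> ((1 + 2 * sqrt E)\<^sup>2) powr (1 / 4)"
    using integral_pow4_le [OF assms] by (intro powr_mono2) auto
  also have "\<dots> = (1 + 2 * sqrt E) powr (2 * (1 / 4))"
    using \<open>0 \<le> E\<close> by (simp add: powr_powr flip: powr_numeral)
  also have "\<dots> = sqrt (1 + 2 * sqrt E)"
    using \<open>0 \<le> E\<close> by (simp add: powr_half_sqrt)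
  finally show ?thesis .
qed

text \<open>Hoelder's inequality with exponents \<open>3\<close> and \<open>3/2\<close> for \<open>\<bar>f\<bar>\<^sup>4\<^sup>/\<^sup>3\<close> and \<open>\<bar>g\<bar>\<^sup>4\<^sup>/\<^sup>3\<close>, obtained by integrating Young's
  inequality for the normalised functions. Normalising by positive upper bounds \<open>A\<close> and \<open>B\<close> instead of
  the integrals themselves covers vanishing integrals without a case distinction.\<close>

lemma Hoelder_four_thirds:
  fixes f g :: "real \<Rightarrow> real"
  assumes f: "continuous_on UNIV f" and g: "continuous_on UNIV g"
    and A: "(\<integral>x. (f x) ^ 4 \<partial>torus) \<le> A" "A > 0" and B: "(\<integral>x. (g x)\<^sup>2 \<partial>torus) \<le> B" "B > 0"
  shows "(\<integral>x. \<bar>f x * g x\<bar> powr (4/3) \<partial>torus) \<le> A powr (1/3) * B powr (2/3)"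
proof -
  define C where "C = A powr (1/3) * B powr (2/3)"
  have "C > 0" using A B by (simp add: C_def)
  have young: "\<bar>a * b\<bar> powr (4/3) \<le> C * (1/3 * (a ^ 4 / A) + 2/3 * (b\<^sup>2 / B))" for a b :: real
  proof (cases "a = 0 \<or> b = 0")
    case True
    then show ?thesis using A B \<open>C > 0\<close> by (auto intro!: mult_nonneg_nonneg)
  next
    case False
    have "(a ^ 4) powr (1/3) = \<bar>a\<bar> powr (4/3)" "(b\<^sup>2) powr (2/3) = \<bar>b\<bar> powr (4/3)"
      unfolding powr_4_abs [symmetric] powr_2_abs [symmetric] powr_powr by simp_all
    then have "\<bar>a * b\<bar> powr (4/3) = C * ((a ^ 4 / A) powr (1/3) * (b\<^sup>2 / B) powr (2/3))"
      using A B by (simp add: C_def abs_mult powr_mult powr_divide)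
    also have "\<dots> \<le> C * (1/3 * (a ^ 4 / A) + 2/3 * (b\<^sup>2 / B))"
      using \<open>C > 0\<close> A B False by (intro mult_left_mono Youngs_inequality_0) auto
    finally show ?thesis .
  qed
  have "(\<integral>x. \<bar>f x * g x\<bar> powr (4/3) \<partial>torus)
      \<le> (\<integral>x. C * (1/3 * ((f x) ^ 4 / A) + 2/3 * ((g x)\<^sup>2 / B)) \<partial>torus)"
    using A B by (intro integral_mono young integrable_torus continuous_intros continuous_on_powr' f g) auto
  also have "\<dots> = C * (1/3 * ((\<integral>x. (f x) ^ 4 \<partial>torus) / A) + 2/3 * ((\<integral>x. (g x)\<^sup>2 \<partial>torus) / B))"
    using A B
    by (subst Bochner_Integration.integral_mult_right_zero, subst Bochner_Integration.integral_add)
       (auto intro!: integrable_torus continuous_intros f g)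
  also have "\<dots> \<le> C * (1/3 * 1 + 2/3 * 1)"
    using A B \<open>C > 0\<close> by (intro mult_left_mono add_mono) auto
  finally show ?thesis by (simp add: C_def)
qed

lemma Lp_norm_f_nl_le:
  assumes u: "continuous_on UNIV u" and E: "(\<integral>x. 1/4 * ((u x)\<^sup>2 - 1)\<^sup>2 \<partial>torus) \<le> E"
    and "E > 0"
  shows "Lp_norm (4/3) (\<lambda>x. f_nl (u x)) \<le> 2 * sqrt E * sqrt (1 + 2 * sqrt E)"
proof -
  have pos: "1 + 2 * sqrt E > 0" using \<open>E > 0\<close> by (simp add: add_pos_pos)
  have f: "f_nl (u x) = u x * ((u x)\<^sup>2 - 1)" for x
    by (simp add: f_nl_def power2_eq_square power3_eq_cube algebra_simps)
  have "(\<integral>x. \<bar>f_nl (u x)\<bar> powr (4/3) \<partial>torus)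
      \<le> ((1 + 2 * sqrt E)\<^sup>2) powr (1/3) * (4 * E) powr (2/3)"
    unfolding f using pos E \<open>E > 0\<close>
    by (intro Hoelder_four_thirds continuous_intros u integral_pow4_le [OF u E]) auto
  then have "Lp_norm (4/3) (\<lambda>x. f_nl (u x))
      \<le> (((1 + 2 * sqrt E)\<^sup>2) powr (1/3) * (4 * E) powr (2/3)) powr (3/4)"
    unfolding Lp_norm_def by (simp, intro powr_mono2) auto
  also have "\<dots> = (1 + 2 * sqrt E) powr (1/2) * (4 * E) powr (1/2)"
    using pos \<open>E > 0\<close> by (simp add: powr_mult powr_powr flip: powr_numeral)
  also have "\<dots> = 2 * sqrt E * sqrt (1 + 2 * sqrt E)"
    using pos \<open>E > 0\<close> by (simp add: powr_half_sqrt real_sqrt_mult)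
  finally show ?thesis .
qed

lemma potential_le_energy:
  assumes "\<nu> > 0" "trig_poly N c u"
  shows "(\<integral>x. 1/4 * ((u x)\<^sup>2 - 1)\<^sup>2 \<partial>torus) \<le> energy \<nu> u"
  using assms by (simp add: energy_trig_poly sum_nonneg)

lemma energy_nonneg: "\<nu> > 0 \<Longrightarrow> energy \<nu> u \<ge> 0"
  unfolding energy_def by (intro Bochner_Integration.integral_nonneg) auto

section \<open>The supremum bound and the theorem\<close>

text \<open>The resolvent representation turns a bound on the energy before the step into a bound on the
  amplitude after the step: the first resolvent smooths \<open>L\<^sup>4\<close>, the second one \<open>L\<^sup>4\<^sup>/\<^sup>3\<close>, to \<open>L\<^sup>\<infinity>\<close>.\<close>

lemma scheme_step_sup_bound:
  assumes step: "scheme_step \<nu> \<tau> N a b" and "\<nu> > 0" "\<tau> > 0"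
    and "B1 > 0" "B2 > 0"
    and biharm: "\<And>g. g \<in> Lp 4 \<Longrightarrow> mean_zero g \<Longrightarrow>
           Linf_norm (biharm_resolvent \<nu> \<tau> g) \<le> ereal (B1 * (\<nu> * \<tau>) powr (-1/16) * Lp_norm 4 g)"
    and lap: "\<And>g. g \<in> Lp (4/3) \<Longrightarrow>
           Linf_norm (lap_biharm_resolvent \<nu> \<tau> (Pi_proj N g))
             \<le> ereal (B2 * \<tau> * (\<nu> * \<tau>) powr (-11/16) * Lp_norm (4/3) g)"
    and "mean_zero a" and E: "energy \<nu> a \<le> E" "E > 0"
  shows "AE x in torus. \<bar>b x\<bar> \<le> B1 * sqrt (1 + 2 * sqrt E) * (\<nu> * \<tau>) powr (-1/16)
            + 2 * B2 * sqrt E * sqrt (1 + 2 * sqrt E) * \<tau> * (\<nu> * \<tau>) powr (-11/16)"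
proof -
  let ?r = "sqrt (1 + 2 * sqrt E)" and ?f = "\<lambda>x. f_nl (a x)"
  have a: "trig_poly N (fourier_coeff a) a" using step by (simp add: scheme_step_def)
  note cont = trig_poly_continuous [OF a]
  have pot: "(\<integral>x. 1/4 * ((a x)\<^sup>2 - 1)\<^sup>2 \<partial>torus) \<le> E"
    using potential_le_energy [OF \<open>\<nu> > 0\<close> a] E(1) by (rule order_trans)
  have per: "periodic1 a" "periodic1 ?f"
    using trig_poly_periodic [OF a] by (simp_all add: periodic1_def)
  have "Linf_norm (biharm_resolvent \<nu> \<tau> a) \<le> ereal (B1 * (\<nu> * \<tau>) powr (-1/16) * Lp_norm 4 a)"
    using per cont by (intro biharm Lp_continuous \<open>mean_zero a\<close>) auto
  also have "\<dots> \<le> ereal (B1 * (\<nu> * \<tau>) powr (-1/16) * ?r)"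
    using Lp_norm_4_le [OF cont pot] \<open>B1 > 0\<close> by (simp add: mult_left_mono)
  finally have 1: "AE x in torus. \<bar>biharm_resolvent \<nu> \<tau> a x\<bar> \<le> B1 * (\<nu> * \<tau>) powr (-1/16) * ?r"
    by (rule Linf_norm_imp_AE)
  have "Linf_norm (lap_biharm_resolvent \<nu> \<tau> (Pi_proj N ?f))
      \<le> ereal (B2 * \<tau> * (\<nu> * \<tau>) powr (-11/16) * Lp_norm (4/3) ?f)"
    using per cont by (intro lap Lp_continuous continuous_intros) auto
  also have "\<dots> \<le> ereal (B2 * \<tau> * (\<nu> * \<tau>) powr (-11/16) * (2 * sqrt E * ?r))"
    using Lp_norm_f_nl_le [OF cont pot \<open>E > 0\<close>] \<open>B2 > 0\<close> \<open>\<tau> > 0\<close>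
    unfolding ereal_less_eq by (intro mult_left_mono) auto
  finally have 2: "AE x in torus. \<bar>lap_biharm_resolvent \<nu> \<tau> (Pi_proj N ?f) x\<bar>
      \<le> B2 * \<tau> * (\<nu> * \<tau>) powr (-11/16) * (2 * sqrt E * ?r)"
    by (rule Linf_norm_imp_AE)
  from 1 2 show ?thesis
  proof eventually_elim
    case (elim x)
    show ?case
      unfolding scheme_step_resolvents [OF step \<open>\<nu> > 0\<close> \<open>\<tau> > 0\<close>]
      using abs_triangle_ineq [of "biharm_resolvent \<nu> \<tau> a x"
          "lap_biharm_resolvent \<nu> \<tau> (Pi_proj N ?f) x"] elim
      by (simp add: mult_ac)
  qed
qed

theorem theorem6p2:
  fixes B1 B2 \<nu> L0 E0 \<beta>1 \<beta>2 \<tau>max \<tau>max1 \<tau> :: real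
    and N :: nat
    and u0 :: "real \<Rightarrow> real"
    and u :: "nat \<Rightarrow> real \<Rightarrow> real"
  assumes "B1 > 0" and "B2 > 0"
    and "\<And>(M::nat) (\<mu>::real) (\<sigma>::real) g. M \<ge> 2 \<Longrightarrow> \<mu> > 0 \<Longrightarrow> \<sigma> > 0 \<Longrightarrow> g \<in> Lp 4 \<Longrightarrow> mean_zero g \<Longrightarrow>
           Linf_norm (biharm_resolvent \<mu> \<sigma> g)
             \<le> ereal (B1 * (\<mu> * \<sigma>) powr (-1/16) * Lp_norm 4 g)"
    and "\<And>(M::nat) (\<mu>::real) (\<sigma>::real) g1. M \<ge> 2 \<Longrightarrow> \<mu> > 0 \<Longrightarrow> \<sigma> > 0 \<Longrightarrow> g1 \<in> Lp (4/3) \<Longrightarrow>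
           Linf_norm (lap_biharm_resolvent \<mu> \<sigma> (Pi_proj M g1))
             \<le> ereal (B2 * \<sigma> * (\<mu> * \<sigma>) powr (-11/16) * Lp_norm (4/3) g1)"
    and "\<nu> > 0" and "N \<ge> 2"
    and "u0 \<in> H1" and "mean_zero u0"
    and "u 0 = Pi_proj N u0"
    and "Linf_norm (u 0) = ereal L0" and "L0 \<noteq> 0"
    and "E0 = energy \<nu> (u 0)"
    and "\<beta>1 = B1 * sqrt (1 + 2 * sqrt E0)"
    and "\<beta>2 = 2 * B2 * sqrt E0 * sqrt (1 + 2 * sqrt E0)"
    and "\<tau>max1 = 0.118 * \<nu> powr (5/3) * min (\<beta>1 powr (-16/3)) (\<beta>2 powr (-16/9))"
    and "\<tau>max = min (8 * \<nu> / (9 * L0 ^ 4)) \<tau>max1"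
    and "0 < \<tau>" and "\<tau> \<le> \<tau>max"
    and "scheme_solution \<nu> \<tau> N u"
  shows "\<forall>n. energy \<nu> (u (Suc n)) \<le> energy \<nu> (u n)"
proof -
  note biharm = assms(3) [OF \<open>N \<ge> 2\<close> \<open>\<nu> > 0\<close> \<open>0 < \<tau>\<close>]
  note lap = assms(4) [OF \<open>N \<ge> 2\<close> \<open>\<nu> > 0\<close> \<open>0 < \<tau>\<close>]
  note step = scheme_solution_step [OF \<open>scheme_solution \<nu> \<tau> N u\<close>]
  define M where "M = \<beta>1 * (\<nu> * \<tau>) powr (-1/16) + \<beta>2 * \<tau> * (\<nu> * \<tau>) powr (-11/16)"
  define K where "K = max \<bar>L0\<bar> M"
  have \<tau>_le: "\<tau> \<le> 8 * \<nu> / (9 * L0 ^ 4)" "\<tau> \<le> \<tau>max1"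
    using \<open>\<tau> \<le> \<tau>max\<close> \<open>\<tau>max = _\<close> by auto
  have "\<tau>max1 \<le> 0.118 * \<nu> powr (5/3) * \<beta>1 powr (-16/3)"
       "\<tau>max1 \<le> 0.118 * \<nu> powr (5/3) * \<beta>2 powr (-16/9)"
    unfolding \<open>\<tau>max1 = _\<close> by (intro mult_left_mono; simp)+
  with \<tau>_le have \<tau>_\<beta>: "\<tau> \<le> 0.118 * \<nu> powr (5/3) * \<beta>1 powr (-16/3)"
       "\<tau> \<le> 0.118 * \<nu> powr (5/3) * \<beta>2 powr (-16/9)"
    by linarith+
  have "E0 \<ge> 0"
    using energy_nonneg [OF \<open>\<nu> > 0\<close>] \<open>E0 = _\<close> by simp
  \<comment> \<open>If \<open>E0 = 0\<close> then \<open>\<beta>2 = 0\<close>, whose negative power is \<open>0\<close> by convention, so no \<open>\<tau>\<close> is admissible.\<close>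
  have "E0 \<noteq> 0"
  proof
    assume "E0 = 0"
    then have "\<beta>2 = 0" using \<open>\<beta>2 = _\<close> by simp
    then show False using \<tau>_\<beta>(2) \<open>0 < \<tau>\<close> by simp
  qed
  then have "E0 > 0" using \<open>E0 \<ge> 0\<close> by simp
  then have \<beta>_pos: "\<beta>1 > 0" "\<beta>2 > 0"
    unfolding \<open>\<beta>1 = _\<close> \<open>\<beta>2 = _\<close> using \<open>B1 > 0\<close> \<open>B2 > 0\<close> by (auto simp: add_pos_pos)
  have K: "3 / 2 * K\<^sup>2 \<le> sqrt (2 * \<nu> / \<tau>)"
    using step_size_imp_initial_threshold [OF \<open>\<nu> > 0\<close> \<open>0 < \<tau>\<close> \<open>L0 \<noteq> 0\<close> \<tau>_le(1)]
      step_size_imp_sup_threshold [OF \<open>\<nu> > 0\<close> \<open>0 < \<tau>\<close> \<beta>_pos \<tau>_\<beta>]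
    by (simp add: K_def M_def max_def)
  have next_bound: "AE x in torus. \<bar>u (Suc n) x\<bar> \<le> K"
    if "mean_zero (u n)" "energy \<nu> (u n) \<le> E0" for n
  proof -
    have "AE x in torus. \<bar>u (Suc n) x\<bar> \<le> M"
      unfolding M_def \<open>\<beta>1 = _\<close> \<open>\<beta>2 = _\<close>
      by (rule scheme_step_sup_bound [OF step \<open>\<nu> > 0\<close> \<open>0 < \<tau>\<close> \<open>B1 > 0\<close> \<open>B2 > 0\<close>
            biharm lap that \<open>E0 > 0\<close>])
    then show ?thesis by eventually_elim (simp add: K_def)
  qed
  have inv: "mean_zero (u n) \<and> energy \<nu> (u n) \<le> E0 \<and> (AE x in torus. \<bar>u n x\<bar> \<le> K)" for n
  proof (induction n)
    case 0
    have "fourier_coeff (u 0) 0 = fourier_coeff u0 0"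
      unfolding \<open>u 0 = _\<close> by (rule fourier_coeff_trig_poly [OF trig_poly_Pi_proj]) simp
    moreover have "AE x in torus. \<bar>u 0 x\<bar> \<le> L0"
      using \<open>Linf_norm (u 0) = _\<close> by (intro Linf_norm_imp_AE) simp
    then have "AE x in torus. \<bar>u 0 x\<bar> \<le> K"
      by eventually_elim (auto simp: K_def)
    ultimately show ?case
      using \<open>mean_zero u0\<close> \<open>E0 = _\<close> by (simp add: mean_zero_iff)
  next
    case (Suc n)
    moreover from Suc have "AE x in torus. \<bar>u (Suc n) x\<bar> \<le> K"
      using next_bound by blast
    moreover from this Suc have "energy \<nu> (u (Suc n)) \<le> energy \<nu> (u n)"
      using energy_step_decreasing [OF step \<open>\<nu> > 0\<close> \<open>0 < \<tau>\<close> _ _ K] by blast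
    moreover have "mean_zero (u (Suc n))"
      using scheme_step_mean_zero [OF step \<open>0 < \<tau>\<close>] Suc by blast
    ultimately show ?case by linarith
  qed
  show ?thesis
  proof
    fix n
    show "energy \<nu> (u (Suc n)) \<le> energy \<nu> (u n)"
      using inv [of n] inv [of "Suc n"]
      by (intro energy_step_decreasing [OF step \<open>\<nu> > 0\<close> \<open>0 < \<tau>\<close> _ _ K]) auto
  qed
qed

end
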